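(* Let $r\in(1,2]$ and $L>0$. Let $\bar\lambda>0$ and $P\in\mathbb N$ be constants for which the uniform Lipschitz property stated in the context holds. Then there exist two positive constants $C_1$ and $C_2$ such that for all sufficiently large $K_n$ with $n/K_n\ge P$ and for each $\lambda\in[0,\bar\lambda]$ (uniformly in $f$), $$\sup_{f\in\mathcal C_H(r,L)}\|\bar f^{[1]}-f\|_\infty\le C_1LK_n^{-r}+C_2\sqrt{\lambda\cdot K_n}\cdot LK_n^{-r},$$ where $\bar f^{[1]}$ is the convex $P$-spline function built from the noise-free data $f(x_1),\dots,f(x_n)$, as defined in the context.
   Context: $\mathcal C_H(r,L)$ is the set of differentiable convex functions $f:[0,1]\to\mathbb R$ with $|f'(x_1)-f'(x_2)|\le L|x_1-x_2|^{r-1}$ for all $x_1,x_2\in[0,1]$. $\|g\|_\infty=\sup_{x\in[0,1]}|g(x)|$. Let $n,K_n$ be positive integers with $K_n\ge2$ and $n/K_n$ an integer; $x_i=i/n$. The linear B-spline basis with knots $k/K_n$ is $B^{[1]}_k(x)=\max\{0,\,1-|K_nx-(k-1)|\}$, $x\in[0,1]$, $k=1,\dots,K_n+1$. Let $X=[B^{[1]}_k(x_i)]_{i,k}\in\mathbb R^{n\times(K_n+1)}$, $\beta_n:=\sum_{i=1}^n(B^{[1]}_k(x_i))^2$ for $k\in\{2,\dots,K_n\}$ (independent of such $k$), $\Gamma:=X^TX/\beta_n$, $D_2\in\mathbb R^{(K_n-1)\times(K_n+1)}$ with $(D_2b)_i=b_i-2b_{i+1}+b_{i+2}$, $\Lambda:=\Gamma+\lambda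 D_2^TD_2$, $\Omega:=\{b\in\mathbb R^{K_n+1}:D_2b\ge0\}$ (componentwise). For $\bar y\in\mathbb R^{K_n+1}$ let $\hat b(\bar y):=\arg\min_{b\in\Omega}\frac12b^T\Lambda b-b^T\bar y$. Uniform Lipschitz property (proved separately in the paper; such constants exist): there is $\kappa_\infty>0$, independent of $n,K_n,\lambda$, such that for all $\lambda\in[0,\bar\lambda]$ and all $K_n$ with $n/K_n\ge P$, $\|\hat b(\bar y^1)-\hat b(\bar y^2)\|_\infty\le\kappa_\infty\|\bar y^1-\bar y^2\|_\infty$ for all $\bar y^1,\bar y^2\in\mathbb R^{K_n+1}$. For $f:[0,1]\to\mathbb R$ put $\vec f=(f(x_1),\dots,f(x_n))^T$, $\check b:=\hat b(X^T\vec f/\beta_n)$ and $\bar f^{[1]}(x):=\sum_{k=1}^{K_n+1}\check b_kB^{[1]}_k(x)$. *)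

theory Defs
  imports
    "HOL-Analysis.Convex"
    "HOL-Library.Extended_Real"
    "Jordan_Normal_Form.Matrix"
begin

text \<open>Functions on \<open>[0,1]\<close> are represented by functions on the reals whose values outside
  \<open>[0,1]\<close> are irrelevant; the derivative is therefore taken within \<open>[0,1]\<close>
  (one-sided at the endpoints).\<close>

definition convex_hoelder :: "real \<Rightarrow> real \<Rightarrow> (real \<Rightarrow> real) set" where
  "convex_hoelder r L = {f. convex_on {0..1} f \<and>
     (\<exists>f'. (\<forall>x\<in>{0..1}. (f has_real_derivative f' x) (at x within {0..1})) \<and>
           (\<forall>x1\<in>{0..1}. \<forall>x2\<in>{0..1}. \<bar>f' x1 - f' x2\<bar> \<le> L * \<bar>x1 - x2\<bar> powr (r - 1)))}"

text \<open>The supremum is taken in the extended reals, so that an unbounded function has norm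
  \<open>\<infinity>\<close> instead of the unspecified value of an unbounded real supremum.\<close>

definition sup_norm :: "(real \<Rightarrow> real) \<Rightarrow> ereal" where
  "sup_norm g = (SUP x\<in>{0..1}. ereal \<bar>g x\<bar>)"

definition linf_norm :: "real vec \<Rightarrow> real" where
  "linf_norm v = Max ((\<lambda>i. \<bar>v $ i\<bar>) ` {..<dim_vec v})"

text \<open>The basis functions are numbered \<open>k = 1, \<dots>, K + 1\<close>, whereas vectors and matrices are
  indexed from \<open>0\<close>: row \<open>i\<close> of the design matrix belongs to the design point
  \<open>(i + 1) / n\<close>, column \<open>k\<close> to the basis function with number \<open>k + 1\<close>.\<close>

definition bspline :: "nat \<Rightarrow> nat \<Rightarrow> real \<Rightarrow> real" where
  "bspline K k x = max 0 (1 - \<bar>real K * x - (real k - 1)\<bar>)"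

definition design_mat :: "nat \<Rightarrow> nat \<Rightarrow> real mat" where
  "design_mat n K = mat n (K + 1) (\<lambda>(i, k). bspline K (k + 1) (real (i + 1) / real n))"

text \<open>If \<open>K\<close> divides \<open>n\<close>, the following sum has the same value for every basis function with number
  in \<open>{2..K}\<close>; number \<open>2\<close> serves as representative, since \<open>K \<ge> 2\<close>.\<close>

definition beta :: "nat \<Rightarrow> nat \<Rightarrow> real" where
  "beta n K = (\<Sum>i = 1..n. (bspline K 2 (real i / real n))\<^sup>2)"

definition Gamma_mat :: "nat \<Rightarrow> nat \<Rightarrow> real mat" where
  "Gamma_mat n K = (1 / beta n K) \<cdot>\<^sub>m (transpose_mat (design_mat n K) * design_mat n K)"

definition D2 :: "nat \<Rightarrow> real mat" where
  "D2 K = mat (K - 1) (K + 1)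
     (\<lambda>(i, j). if j = i then 1 else if j = i + 1 then - 2 else if j = i + 2 then 1 else 0)"

definition Lambda_mat :: "nat \<Rightarrow> nat \<Rightarrow> real \<Rightarrow> real mat" where
  "Lambda_mat n K lam = Gamma_mat n K + lam \<cdot>\<^sub>m (transpose_mat (D2 K) * D2 K)"

definition Omega :: "nat \<Rightarrow> real vec set" where
  "Omega K = {b \<in> carrier_vec (K + 1). 0\<^sub>v (K - 1) \<le> D2 K *\<^sub>v b}"

text \<open>The minimizer is unique whenever \<open>Lambda_mat n K lam\<close> is positive definite, in particular
  for \<open>lam \<ge> 0\<close> and \<open>n / K \<ge> 2\<close>.\<close>

definition bhat :: "nat \<Rightarrow> nat \<Rightarrow> real \<Rightarrow> real vec \<Rightarrow> real vec" where
  "bhat n K lam y =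
     arg_min (\<lambda>b. 1 / 2 * scalar_prod b (Lambda_mat n K lam *\<^sub>v b) - scalar_prod b y)
       (\<lambda>b. b \<in> Omega K)"

definition uniform_lipschitz :: "real \<Rightarrow> nat \<Rightarrow> bool" where
  "uniform_lipschitz lambar P \<longleftrightarrow>
     (\<exists>\<kappa>>0. \<forall>lam\<in>{0..lambar}. \<forall>n K.
        n > 0 \<and> K \<ge> 2 \<and> K dvd n \<and> real n / real K \<ge> real P \<longrightarrow>
        (\<forall>y1\<in>carrier_vec (K + 1). \<forall>y2\<in>carrier_vec (K + 1).
           linf_norm (bhat n K lam y1 - bhat n K lam y2) \<le> \<kappa> * linf_norm (y1 - y2)))"

definition sample_vec :: "nat \<Rightarrow> (real \<Rightarrow> real) \<Rightarrow> real vec" where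
  "sample_vec n f = vec n (\<lambda>i. f (real (i + 1) / real n))"

definition bcheck :: "nat \<Rightarrow> nat \<Rightarrow> real \<Rightarrow> (real \<Rightarrow> real) \<Rightarrow> real vec" where
  "bcheck n K lam f =
     bhat n K lam ((1 / beta n K) \<cdot>\<^sub>v (transpose_mat (design_mat n K) *\<^sub>v sample_vec n f))"

definition fbar :: "nat \<Rightarrow> nat \<Rightarrow> real \<Rightarrow> (real \<Rightarrow> real) \<Rightarrow> real \<Rightarrow> real" where
  "fbar n K lam f x = (\<Sum>k = 1..K + 1. bcheck n K lam f $ (k - 1) * bspline K k x)"

end

theory Submission
  imports Defs
begin

text \<open>If \<open>b\<close> lists the values of \<open>f\<close> at the knots, then \<open>b \<in> \<Omega>\<close> by convexity, so \<open>b\<close> is the exact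
  minimizer for the data \<open>\<Lambda> b\<close>. The Lipschitz property thus bounds the distance from the fitted
  coefficients to \<open>b\<close> by a multiple of the residual \<open>X\<^sup>T(f - X b)/\<beta> - \<lambda> D\<^sup>T D b\<close>. Both of its parts are of
  order \<open>L K\<^sup>-\<^sup>r\<close>: linear interpolation of \<open>f\<close> has an error of at most \<open>L K\<^sup>-\<^sup>r\<close>, and second differences of
  \<open>f\<close> are at most \<open>2 L K\<^sup>-\<^sup>r\<close>. Since \<open>\<lambda>\<close> is bounded, the term with the factor \<open>\<surd>(\<lambda> K)\<close> is only slack.

  Uniqueness of the minimizer needs at least two design points per knot interval. This costs
  nothing, since the Lipschitz property fails for \<open>P \<le> 1\<close>.\<close>

section \<open>Linear splines in the hat basis\<close>

definition spline :: "nat \<Rightarrow> real vec \<Rightarrow> real \<Rightarrow> real" where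
  "spline K b x = (\<Sum>k = 1..K + 1. b $ (k - 1) * bspline K k x)"

lemma bspline_nonneg: "0 \<le> bspline K k x"
  by (simp add: bspline_def)

lemma bspline_le_1: "bspline K k x \<le> 1"
  by (simp add: bspline_def)

text \<open>On a knot interval only the hats peaking at its two ends survive, so the sum collapses
  to linear interpolation. Hat number \<open>k\<close> peaks at \<open>(k - 1) / K\<close>, hence
  the numbers \<open>j + 1\<close> and \<open>j + 2\<close>. Arbitrary coefficients \<open>c\<close>
  cover both splines and the partition of unity.\<close>

lemma sum_bspline_eq:
  fixes c :: "nat \<Rightarrow> real"
  assumes "j < K" "real j \<le> real K * x" "real K * x \<le> real j + 1"
  shows "(\<Sum>k = 1..K + 1. c (k - 1) * bspline K k x)
         = c j * (1 - (real K * x - real j)) + c (j + 1) * (real K * x - real j)"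
proof -
  have "(\<Sum>k = 1..K + 1. c (k - 1) * bspline K k x)
      = (\<Sum>k\<in>{j + 1, j + 2}. c (k - 1) * bspline K k x)"
  proof (rule sum.mono_neutral_right)
    show "\<forall>k\<in>{1..K + 1} - {j + 1, j + 2}. c (k - 1) * bspline K k x = 0"
    proof
      fix k assume k: "k \<in> {1..K + 1} - {j + 1, j + 2}"
      then consider "k \<le> j" | "k \<ge> j + 3" by fastforce
      then have "1 \<le> \<bar>real K * x - (real k - 1)\<bar>"
      proof cases
        case 1
        then have "real k \<le> real j" by simp
        with assms show ?thesis by linarith
      next
        case 2
        then have "real k \<ge> real j + 3" by linarith
        with assms show ?thesis by linarith
      qed
      then show "c (k - 1) * bspline K k x = 0" by (simp add: bspline_def)
    qed
  qed (use assms in auto)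
  also have "\<dots> = c j * bspline K (j + 1) x + c (j + 1) * bspline K (j + 2) x" by simp
  also have "bspline K (j + 1) x = 1 - (real K * x - real j)"
    using assms by (simp add: bspline_def)
  also have "bspline K (j + 2) x = real K * x - real j"
    using assms by (simp add: bspline_def)
  finally show ?thesis .
qed

lemma spline_eq:
  assumes "j < K" "real j \<le> real K * x" "real K * x \<le> real j + 1"
  shows "spline K b x = b $ j * (1 - (real K * x - real j)) + b $ (j + 1) * (real K * x - real j)"
  unfolding spline_def by (rule sum_bspline_eq[OF assms])

lemma knot_interval_exists:
  assumes "K > 0" "0 \<le> x" "x \<le> 1"
  obtains j where "j < K" "real j \<le> real K * x" "real K * x \<le> real j + 1"
proof (cases "x = 1")
  case True
  \<comment> \<open>At the right end the floor of \<open>K * x\<close> is \<open>K\<close>, which is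
    no left knot; the last interval is taken instead.\<close>
  show ?thesis by (rule that[of "K - 1"]) (use assms True in \<open>auto simp: of_nat_diff\<close>)
next
  case False
  with assms have lt: "real K * x < real K" by simp
  have nn: "0 \<le> real K * x" using assms by simp
  show ?thesis
  proof (rule that[of "nat \<lfloor>real K * x\<rfloor>"])
    show "nat \<lfloor>real K * x\<rfloor> < K" using lt nn by linarith
  qed (use nn in linarith)+
qed

lemma spline_knot:
  assumes "K > 0" "j \<le> K"
  shows "spline K b (real j / real K) = b $ j"
proof (cases "j < K")
  case True
  then show ?thesis using spline_eq[of j K "real j / real K" b] assms by simp
next
  case False
  with assms have "j = K" "j - 1 < K" by auto
  then show ?thesis using spline_eq[of "j - 1" K 1 b] assms by (simp add: of_nat_diff)
qed

lemma sum_bspline_eq_1: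
  assumes "K > 0" "0 \<le> x" "x \<le> 1"
  shows "(\<Sum>k = 1..K + 1. bspline K k x) = 1"
proof -
  obtain j where "j < K" "real j \<le> real K * x" "real K * x \<le> real j + 1"
    using knot_interval_exists[OF assms] .
  from sum_bspline_eq[OF this, of "\<lambda>_. 1"] show ?thesis by simp
qed

text \<open>The difference is a spline with coefficients at most \<open>e\<close> in modulus; as the
  hats are nonnegative and sum to 1, its values are averages of them.\<close>

lemma abs_spline_diff_le:
  assumes "K > 0" "0 \<le> x" "x \<le> 1"
    and "\<And>k. k \<le> K \<Longrightarrow> \<bar>b $ k - c $ k\<bar> \<le> e"
  shows "\<bar>spline K b x - spline K c x\<bar> \<le> e"
proof -
  have "\<bar>spline K b x - spline K c x\<bar> = \<bar>\<Sum>k = 1..K + 1. (b $ (k - 1) - c $ (k - 1)) * bspline K k x\<bar>"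
    unfolding spline_def by (simp add: sum_subtractf left_diff_distrib del: sum.cl_ivl_Suc)
  also have "\<dots> \<le> (\<Sum>k = 1..K + 1. e * bspline K k x)"
    by (intro sum_abs[THEN order_trans] sum_mono)
      (use assms(4) in \<open>auto simp: abs_mult bspline_nonneg intro!: mult_right_mono\<close>)
  also have "\<dots> = e" using sum_bspline_eq_1[OF assms(1-3)]
    by (simp add: sum_distrib_left[symmetric] del: sum.cl_ivl_Suc)
  finally show ?thesis .
qed

section \<open>Size of the hats on the design grid\<close>

text \<open>With \<open>n = K * m\<close> there are \<open>m\<close> design points per knot
  interval. A hat is nonzero only strictly within one knot spacing of its peak, hence at fewer than
  \<open>2 * m\<close> points, and it never exceeds 1.\<close>

lemma sum_bspline_design_le:
  assumes "m > 0" "K > 0"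
  shows "(\<Sum>i = 1..K * m. bspline K k (real i / real (K * m))) \<le> 2 * real m"
proof -
  let ?A = "{i \<in> {1..K * m}. bspline K k (real i / real (K * m)) \<noteq> 0}"
  have sub: "?A \<subseteq> {Suc (k * m) - 2 * m..<k * m}"
  proof
    fix i assume "i \<in> ?A"
    then have "\<bar>real i / real m - (real k - 1)\<bar> < 1"
      using assms by (auto simp: bspline_def max_def split: if_splits)
    then have "real i / real m < real k" "real k - 2 < real i / real m" by linarith+
    then have "real i < real k * real m" "real k * real m < real i + 2 * real m"
      using assms by (simp_all add: field_simps)
    then have "real i < real (k * m)" "real (k * m) < real (i + 2 * m)" by simp_all
    then have "i < k * m" "k * m < i + 2 * m" by (simp_all only: of_nat_less_iff)
    then show "i \<in> {Suc (k * m) - 2 * m..<k * m}" by auto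
  qed
  have card: "card ?A \<le> 2 * m"
    using card_mono[OF _ sub] by auto
  have "(\<Sum>i = 1..K * m. bspline K k (real i / real (K * m)))
      = (\<Sum>i\<in>?A. bspline K k (real i / real (K * m)))"
    by (rule sum.mono_neutral_right) auto
  also have "\<dots> \<le> (\<Sum>i\<in>?A. 1)" by (intro sum_mono bspline_le_1)
  also have "\<dots> \<le> 2 * real m" using card by simp
  finally show ?thesis .
qed

text \<open>The points from \<open>m\<close> to \<open>m + m div 2\<close> lie at most half a knot
  spacing to the right of the peak of hat 2, where it is at least 1/2. There are at least
  \<open>m / 2\<close> of them, each adding at least 1/4. Column sums \<open>2 * m\<close> divided
  by \<open>beta\<close> are thus at most 16, independently of \<open>n\<close> and
  \<open>K\<close>.\<close>

lemma beta_ge: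
  assumes "m > 0" "K \<ge> 2"
  shows "real m / 8 \<le> beta (K * m) K"
proof -
  let ?B = "{m..m + m div 2}"
  have "2 * m \<le> K * m" using assms by simp
  then have "m + m div 2 \<le> K * m" by linarith
  then have sub: "?B \<subseteq> {1..K * m}" using assms by auto
  have "real m / 8 \<le> real (card ?B) * (1 / 4)" by simp
  also have "\<dots> = (\<Sum>i\<in>?B. (1 / 2)\<^sup>2)" by (simp add: power2_eq_square)
  also have "\<dots> \<le> (\<Sum>i\<in>?B. (bspline K 2 (real i / real (K * m)))\<^sup>2)"
  proof (intro sum_mono power_mono)
    fix i assume "i \<in> ?B"
    then have "real m \<le> real i" "2 * real i \<le> 3 * real m" by auto
    then have "1 \<le> real i / real m" "real i / real m \<le> 3 / 2"
      using assms by (simp_all add: field_simps)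
    then have "1 / 2 \<le> 1 - \<bar>real i / real m - (real 2 - 1)\<bar>" by simp
    moreover have "real K * (real i / real (K * m)) = real i / real m" using assms by simp
    ultimately show "1 / 2 \<le> bspline K 2 (real i / real (K * m))"
      unfolding bspline_def le_max_iff_disj by simp
  qed simp
  also have "\<dots> \<le> beta (K * m) K"
    unfolding beta_def by (rule sum_mono2) (use sub in auto)
  finally show ?thesis .
qed

section \<open>The matrices in coordinates\<close>

lemma design_mat_carrier: "design_mat n K \<in> carrier_mat n (K + 1)"
  by (simp add: design_mat_def)

lemma D2_carrier: "D2 K \<in> carrier_mat (K - 1) (K + 1)"
  by (simp add: D2_def)

lemma Lambda_mat_carrier: "Lambda_mat n K lam \<in> carrier_mat (K + 1) (K + 1)"
  unfolding Lambda_mat_def Gamma_mat_def D2_def design_mat_def by auto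

lemma Omega_carrier: "b \<in> Omega K \<Longrightarrow> b \<in> carrier_vec (K + 1)"
  by (simp add: Omega_def)

lemma design_mat_mult_vec_nth:
  assumes "b \<in> carrier_vec (K + 1)" "i < n"
  shows "(design_mat n K *\<^sub>v b) $ i = spline K b (real (i + 1) / real n)"
proof -
  have "(design_mat n K *\<^sub>v b) $ i
      = (\<Sum>k<K + 1. b $ k * bspline K (k + 1) (real (i + 1) / real n))"
    using assms unfolding design_mat_def mult_mat_vec_def scalar_prod_def
    by (auto simp: atLeast0LessThan mult.commute intro!: sum.cong)
  then show ?thesis
    unfolding spline_def One_nat_def sum.atLeast1_atMost_eq by simp
qed

lemma D2_mult_vec_nth:
  assumes "b \<in> carrier_vec (K + 1)" "i < K - 1"
  shows "(D2 K *\<^sub>v b) $ i = b $ i - 2 * b $ (i + 1) + b $ (i + 2)"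
proof -
  let ?d = "\<lambda>j. if j = i then 1 else if j = i + 1 then - 2 else if j = i + 2 then 1 else (0::real)"
  have "(D2 K *\<^sub>v b) $ i = (\<Sum>j\<in>{0..<K + 1}. ?d j * b $ j)"
    using assms unfolding D2_def mult_mat_vec_def scalar_prod_def by (auto intro!: sum.cong)
  also have "\<dots> = (\<Sum>j\<in>{i, i + 1, i + 2}. ?d j * b $ j)"
    by (rule sum.mono_neutral_right) (use assms in auto)
  finally show ?thesis by simp
qed

lemma smult_mat_mult_vec:
  assumes "A \<in> carrier_mat p q" "v \<in> carrier_vec q"
  shows "(a \<cdot>\<^sub>m A) *\<^sub>v v = a \<cdot>\<^sub>v (A *\<^sub>v v)"
  by (rule eq_vecI) (use assms in \<open>auto simp: smult_scalar_prod_distrib[of _ q]\<close>)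

lemma Lambda_mat_mult_vec:
  assumes "b \<in> carrier_vec (K + 1)"
  shows "Lambda_mat n K lam *\<^sub>v b
    = (1 / beta n K) \<cdot>\<^sub>v (transpose_mat (design_mat n K) *\<^sub>v (design_mat n K *\<^sub>v b))
      + lam \<cdot>\<^sub>v (transpose_mat (D2 K) *\<^sub>v (D2 K *\<^sub>v b))"
proof -
  let ?X = "design_mat n K" and ?D = "D2 K"
  have X: "?X \<in> carrier_mat n (K + 1)" and D: "?D \<in> carrier_mat (K - 1) (K + 1)"
    by (rule design_mat_carrier, rule D2_carrier)
  have XX: "transpose_mat ?X * ?X \<in> carrier_mat (K + 1) (K + 1)"
    and DD: "transpose_mat ?D * ?D \<in> carrier_mat (K + 1) (K + 1)"
    using X D by auto
  have "Lambda_mat n K lam *\<^sub>v b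
      = ((1 / beta n K) \<cdot>\<^sub>m (transpose_mat ?X * ?X)) *\<^sub>v b + (lam \<cdot>\<^sub>m (transpose_mat ?D * ?D)) *\<^sub>v b"
    unfolding Lambda_mat_def Gamma_mat_def
    by (rule add_mult_distrib_mat_vec[of _ "K + 1" "K + 1"]) (use XX DD assms in auto)
  also have "\<dots> = (1 / beta n K) \<cdot>\<^sub>v ((transpose_mat ?X * ?X) *\<^sub>v b)
      + lam \<cdot>\<^sub>v ((transpose_mat ?D * ?D) *\<^sub>v b)"
    by (simp add: smult_mat_mult_vec[OF XX assms] smult_mat_mult_vec[OF DD assms])
  also have "(transpose_mat ?X * ?X) *\<^sub>v b = transpose_mat ?X *\<^sub>v (?X *\<^sub>v b)"
    by (rule assoc_mult_mat_vec) (use X assms in auto)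
  also have "(transpose_mat ?D * ?D) *\<^sub>v b = transpose_mat ?D *\<^sub>v (?D *\<^sub>v b)"
    by (rule assoc_mult_mat_vec) (use D assms in auto)
  finally show ?thesis .
qed

text \<open>Moving both transposes to the other factor expresses the bilinear form through fitted
  values and second differences; the objective is handled through these two.\<close>

lemma scalar_prod_Lambda_mat:
  assumes "b \<in> carrier_vec (K + 1)" "c \<in> carrier_vec (K + 1)"
  shows "scalar_prod b (Lambda_mat n K lam *\<^sub>v c)
    = 1 / beta n K * scalar_prod (design_mat n K *\<^sub>v b) (design_mat n K *\<^sub>v c)
      + lam * scalar_prod (D2 K *\<^sub>v b) (D2 K *\<^sub>v c)"
proof -
  let ?X = "design_mat n K" and ?D = "D2 K"
  have X: "?X \<in> carrier_mat n (K + 1)" and D: "?D \<in> carrier_mat (K - 1) (K + 1)"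
    by (rule design_mat_carrier, rule D2_carrier)
  have Xc: "?X *\<^sub>v c \<in> carrier_vec n" and Dc: "?D *\<^sub>v c \<in> carrier_vec (K - 1)"
    using X D assms by auto
  have tX: "transpose_mat ?X *\<^sub>v (?X *\<^sub>v c) \<in> carrier_vec (K + 1)"
    and tD: "transpose_mat ?D *\<^sub>v (?D *\<^sub>v c) \<in> carrier_vec (K + 1)"
    using X D Xc Dc by (auto intro!: mult_mat_vec_carrier)
  have "scalar_prod b (transpose_mat ?X *\<^sub>v (?X *\<^sub>v c)) = scalar_prod (?X *\<^sub>v b) (?X *\<^sub>v c)"
    using transpose_vec_mult_scalar[OF X assms(1) Xc] comm_scalar_prod[OF assms(1) tX]
      comm_scalar_prod[OF mult_mat_vec_carrier[OF X assms(1)] Xc] by simp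
  moreover have "scalar_prod b (transpose_mat ?D *\<^sub>v (?D *\<^sub>v c)) = scalar_prod (?D *\<^sub>v b) (?D *\<^sub>v c)"
    using transpose_vec_mult_scalar[OF D assms(1) Dc] comm_scalar_prod[OF assms(1) tD]
      comm_scalar_prod[OF mult_mat_vec_carrier[OF D assms(1)] Dc] by simp
  ultimately show ?thesis
    unfolding Lambda_mat_mult_vec[OF assms(2)]
    using scalar_prod_add_distrib[OF assms(1), of "(1 / beta n K) \<cdot>\<^sub>v (transpose_mat ?X *\<^sub>v (?X *\<^sub>v c))"
        "lam \<cdot>\<^sub>v (transpose_mat ?D *\<^sub>v (?D *\<^sub>v c))"] tX tD assms
    by simp
qed

section \<open>The objective and its minimizers\<close>

lemma scalar_prod_self:
  fixes u :: "real vec"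
  shows "scalar_prod u u = (\<Sum>i<dim_vec u. (u $ i)\<^sup>2)"
  by (simp add: scalar_prod_def power2_eq_square atLeast0LessThan)

lemma scalar_prod_self_nonneg:
  fixes u :: "real vec"
  shows "0 \<le> scalar_prod u u"
  by (simp add: scalar_prod_self sum_nonneg)

lemma scalar_prod_self_eq_0:
  fixes u :: "real vec"
  assumes "scalar_prod u u = 0" "u \<in> carrier_vec m"
  shows "u = 0\<^sub>v m"
proof (rule eq_vecI)
  fix i assume "i < dim_vec (0\<^sub>v m)"
  then have "i < dim_vec u" using assms by simp
  then have "(u $ i)\<^sup>2 = 0"
    using assms(1) by (auto simp: scalar_prod_self sum_nonneg_eq_0_iff)
  then show "u $ i = 0\<^sub>v m $ i" using \<open>i < dim_vec (0\<^sub>v m)\<close> by simp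
qed (use assms in simp)

lemma scalar_prod_diff_self:
  fixes u v :: "real vec"
  assumes "u \<in> carrier_vec m" "v \<in> carrier_vec m"
  shows "scalar_prod (u - v) (u - v) = scalar_prod u u - 2 * scalar_prod u v + scalar_prod v v"
proof -
  have uv: "u - v \<in> carrier_vec m" using assms by simp
  show ?thesis
    unfolding minus_scalar_prod_distrib[OF assms uv]
      scalar_prod_minus_distrib[OF assms(1) assms] scalar_prod_minus_distrib[OF assms(2) assms]
    using comm_scalar_prod[OF assms] by simp
qed

definition objective :: "nat \<Rightarrow> nat \<Rightarrow> real \<Rightarrow> real vec \<Rightarrow> real vec \<Rightarrow> real" where
  "objective n K lam y b = 1 / 2 * scalar_prod b (Lambda_mat n K lam *\<^sub>v b) - scalar_prod b y"

text \<open>Exposes the choice operator behind \<open>arg_min\<close>: if a minimizer exists,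
  \<open>someI\<close> yields minimality; if none exists, the value is a choice from the empty
  predicate, the same for all data.\<close>

lemma bhat_eq: "bhat n K lam y = (SOME b. is_arg_min (objective n K lam y) (\<lambda>b. b \<in> Omega K) b)"
  by (simp add: bhat_def arg_min_def objective_def[abs_def])

text \<open>Completing the square: for data \<open>\<Lambda> c\<close> the linear term is the one
  that turns the difference into half the quadratic form of \<open>b - c\<close>.\<close>

lemma objective_diff:
  fixes n K :: nat and lam :: real and b c :: "real vec"
  assumes "b \<in> carrier_vec (K + 1)" "c \<in> carrier_vec (K + 1)"
  defines "u \<equiv> design_mat n K *\<^sub>v b - design_mat n K *\<^sub>v c"
    and "w \<equiv> D2 K *\<^sub>v b - D2 K *\<^sub>v c"
  shows "objective n K lam (Lambda_mat n K lam *\<^sub>v c) b - objective n K lam (Lambda_mat n K lam *\<^sub>v c) c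
    = 1 / 2 * (1 / beta n K * scalar_prod u u + lam * scalar_prod w w)"
proof -
  have *: "design_mat n K *\<^sub>v b \<in> carrier_vec n" "design_mat n K *\<^sub>v c \<in> carrier_vec n"
    "D2 K *\<^sub>v b \<in> carrier_vec (K - 1)" "D2 K *\<^sub>v c \<in> carrier_vec (K - 1)"
    using assms(1,2) design_mat_carrier D2_carrier by (auto intro!: mult_mat_vec_carrier)
  show ?thesis
    unfolding objective_def u_def w_def scalar_prod_Lambda_mat[OF assms(1,1)]
      scalar_prod_Lambda_mat[OF assms(1,2)] scalar_prod_Lambda_mat[OF assms(2,2)]
      scalar_prod_diff_self[OF *(1,2)] scalar_prod_diff_self[OF *(3,4)]
    by (simp add: algebra_simps add_divide_distrib diff_divide_distrib)
qed

text \<open>By \<open>objective_diff\<close>, \<open>c\<close> is a minimizer, so the chosen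
  \<open>b\<close> has the same objective value and both squares vanish. This settles the fitted
  values; equality of the coefficients depends on the design and is left to
  \<open>design_mat_inj\<close>.\<close>

lemma bhat_Lambda_mat:
  fixes n K :: nat and lam :: real and c :: "real vec"
  assumes c: "c \<in> Omega K" and lam: "lam \<ge> 0" and beta: "beta n K > 0"
  defines "b \<equiv> bhat n K lam (Lambda_mat n K lam *\<^sub>v c)"
  shows "b \<in> Omega K" "design_mat n K *\<^sub>v b = design_mat n K *\<^sub>v c"
proof -
  let ?Q = "objective n K lam (Lambda_mat n K lam *\<^sub>v c)"
  have nn: "0 \<le> 1 / beta n K * scalar_prod u u" "0 \<le> lam * scalar_prod u u" for u :: "real vec"
    using lam beta by (simp_all add: scalar_prod_self_nonneg)
  have "0 \<le> ?Q a - ?Q c" if "a \<in> Omega K" for a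
    unfolding objective_diff[OF Omega_carrier[OF that] Omega_carrier[OF c]]
    by (intro mult_nonneg_nonneg[of "1 / 2"] add_nonneg_nonneg nn) simp
  then have "?Q c \<le> ?Q a" if "a \<in> Omega K" for a
    using that by simp
  then have "is_arg_min ?Q (\<lambda>b. b \<in> Omega K) c"
    using c by (auto simp: is_arg_min_def not_less)
  then have "is_arg_min ?Q (\<lambda>b. b \<in> Omega K) b"
    unfolding b_def bhat_eq by (rule someI)
  then have b: "b \<in> Omega K" and le: "?Q b \<le> ?Q c"
    using c by (auto simp: is_arg_min_def not_less)
  show "b \<in> Omega K" by (fact b)
  let ?u = "design_mat n K *\<^sub>v b - design_mat n K *\<^sub>v c"
  let ?w = "D2 K *\<^sub>v b - D2 K *\<^sub>v c"
  have le_0: "p \<le> 0" if "1 / 2 * (p + q) \<le> 0" "0 \<le> q" for p q :: real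
    using that by (simp add: mult_le_0_iff)
  have "1 / beta n K * scalar_prod ?u ?u \<le> 0"
  proof (rule le_0)
    show "1 / 2 * (1 / beta n K * scalar_prod ?u ?u + lam * scalar_prod ?w ?w) \<le> 0"
      unfolding objective_diff[OF Omega_carrier[OF b] Omega_carrier[OF c], symmetric] using le by simp
  qed (rule nn)
  then have z: "scalar_prod ?u ?u = 0"
    using beta scalar_prod_self_nonneg[of ?u] by (simp add: divide_le_0_iff)
  have car: "design_mat n K *\<^sub>v b \<in> carrier_vec n" "design_mat n K *\<^sub>v c \<in> carrier_vec n"
    using Omega_carrier[OF b] Omega_carrier[OF c] design_mat_carrier
    by (auto intro!: mult_mat_vec_carrier)
  then have "?u = 0\<^sub>v n" by (intro scalar_prod_self_eq_0[OF z]) auto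
  show "design_mat n K *\<^sub>v b = design_mat n K *\<^sub>v c"
  proof (rule eq_vecI)
    fix i assume "i < dim_vec (design_mat n K *\<^sub>v c)"
    then have i: "i < n" using carrier_vecD[OF car(2)] by simp
    then have "?u $ i = 0" using \<open>?u = 0\<^sub>v n\<close> by simp
    then show "(design_mat n K *\<^sub>v b) $ i = (design_mat n K *\<^sub>v c) $ i"
      using index_minus_vec(1)[of i "design_mat n K *\<^sub>v c" "design_mat n K *\<^sub>v b"] carrier_vecD[OF car(2)] i
      by (simp del: index_mult_mat_vec dim_mult_mat_vec)
  qed (use car in simp)
qed

text \<open>All knots but 0 are design points, where the spline shows its coefficient. The remaining
  coefficient is recovered from the first design point: it lies inside the first knot interval when
  \<open>m \<ge> 2\<close>, so hat 1 has the positive value \<open>1 - 1 / m\<close> there.\<close>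

lemma design_mat_inj:
  assumes "m \<ge> 2" "K > 0" and b: "b \<in> carrier_vec (K + 1)" and c: "c \<in> carrier_vec (K + 1)"
    and eq: "design_mat (K * m) K *\<^sub>v b = design_mat (K * m) K *\<^sub>v c"
  shows "b = c"
proof -
  have sp: "spline K b (real (Suc i) / real (K * m)) = spline K c (real (Suc i) / real (K * m))"
    if "i < K * m" for i
    using eq design_mat_mult_vec_nth[OF b that] design_mat_mult_vec_nth[OF c that] by simp
  have pos: "b $ j = c $ j" if j: "1 \<le> j" "j \<le> K" for j
  proof -
    \<comment> \<open>Knot \<open>j / K\<close> is design point number \<open>j * m\<close>, which
      is row \<open>j * m - 1\<close>.\<close>
    have "j * m \<ge> 1" "j * m \<le> K * m" using j assms(1) by auto
    then have "j * m - 1 < K * m" "Suc (j * m - 1) = j * m" by linarith+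
    then have "spline K b (real (j * m) / real (K * m)) = spline K c (real (j * m) / real (K * m))"
      using sp[of "j * m - 1"] by simp
    moreover have "real (j * m) / real (K * m) = real j / real K" using assms(1) by simp
    ultimately show ?thesis using spline_knot[of K j] j assms(2) by simp
  qed
  have "K * m > 0" using assms(1,2) by simp
  then have s0: "spline K b (1 / real (K * m)) = spline K c (1 / real (K * m))"
    using sp[of 0] by simp
  have K1: "real K * (1 / real (K * m)) = 1 / real m" using assms(2) by simp
  have "0 < 1 - 1 / real m" using assms(1) by simp
  moreover have "b $ 0 * (1 - 1 / real m) = c $ 0 * (1 - 1 / real m)"
    using s0 spline_eq[of 0 K "1 / real (K * m)" b] spline_eq[of 0 K "1 / real (K * m)" c]
      K1 assms(1,2) pos[of 1] by (simp del: of_nat_mult)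
  ultimately have zero: "b $ 0 = c $ 0" by (metis less_irrefl mult_right_cancel)
  show ?thesis
  proof (rule eq_vecI)
    fix i assume "i < dim_vec c"
    then have "i \<le> K" using c by simp
    then show "b $ i = c $ i" using pos[of i] zero by (cases i) auto
  qed (use b c in simp)
qed

lemma bhat_Lambda_mat_eq:
  assumes "m \<ge> 2" "K \<ge> 2" "lam \<ge> 0" and c: "c \<in> Omega K"
  shows "bhat (K * m) K lam (Lambda_mat (K * m) K lam *\<^sub>v c) = c"
proof -
  have beta: "beta (K * m) K > 0" using beta_ge[of m K] assms(1,2) by simp
  note b = bhat_Lambda_mat[OF c assms(3) beta]
  show ?thesis
    by (rule design_mat_inj[OF assms(1) _ Omega_carrier[OF b(1)] Omega_carrier[OF c] b(2)])
      (use assms(2) in simp)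
qed

section \<open>Norm bounds and interpolation error\<close>

lemma abs_nth_le_linf_norm:
  assumes "i < dim_vec v"
  shows "\<bar>v $ i\<bar> \<le> linf_norm v"
  unfolding linf_norm_def by (rule Max_ge) (use assms in auto)

lemma linf_norm_le:
  assumes "dim_vec v > 0" "\<And>i. i < dim_vec v \<Longrightarrow> \<bar>v $ i\<bar> \<le> e"
  shows "linf_norm v \<le> e"
  unfolding linf_norm_def by (rule Max.boundedI) (use assms in auto)

lemma transpose_mult_vec_nth:
  assumes "A \<in> carrier_mat p q" "v \<in> carrier_vec p" "k < q"
  shows "(transpose_mat A *\<^sub>v v) $ k = (\<Sum>i<p. A $$ (i, k) * v $ i)"
  using assms by (auto simp: scalar_prod_def atLeast0LessThan)

text \<open>The mean value theorem on either side of the intermediate point turns the error into a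
  multiple of \<open>f' z1 - f' z2\<close>, to which the Hoelder condition applies. The factor
  \<open>t * (1 - t)\<close> is kept because its value 1/4 at the midpoint is needed for second
  differences.\<close>

lemma convex_hoelder_interpolation:
  assumes f: "f \<in> convex_hoelder r L" and "1 < r" "L > 0"
    and ab: "0 \<le> a" "a < b" "b \<le> 1" and t: "0 \<le> t" "t \<le> 1"
  shows "\<bar>f ((1 - t) * a + t * b) - ((1 - t) * f a + t * f b)\<bar> \<le> t * (1 - t) * (L * (b - a) powr r)"
proof (cases "t = 0 \<or> t = 1")
  case True
  then show ?thesis by auto
next
  case False
  then have t': "0 < t" "t < 1" using t by auto
  define x where "x = (1 - t) * a + t * b"
  have xa: "x - a = t * (b - a)" and bx: "b - x = (1 - t) * (b - a)"
    by (simp_all add: x_def algebra_simps)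
  have "0 < x - a" "0 < b - x" unfolding xa bx using t' ab by simp_all
  then have x: "a < x" "x < b" by simp_all
  obtain f' where der: "\<And>z. z \<in> {0..1} \<Longrightarrow> (f has_real_derivative f' z) (at z within {0..1})"
    and hoelder: "\<And>z1 z2. \<lbrakk>z1 \<in> {0..1}; z2 \<in> {0..1}\<rbrakk> \<Longrightarrow> \<bar>f' z1 - f' z2\<bar> \<le> L * \<bar>z1 - z2\<bar> powr (r - 1)"
    using f unfolding convex_hoelder_def by blast
  have mean_value: "\<exists>z. c < z \<and> z < d \<and> f d - f c = (d - c) * f' z"
    if cd: "0 \<le> c" "c < d" "d \<le> 1" for c d
  proof -
    have "continuous_on {0..1} f"
      using der by (rule DERIV_continuous_on)
    then have "continuous_on {c..d} f"
      by (rule continuous_on_subset) (use cd in auto)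
    \<comment> \<open>Here \<open>z\<close> is interior to the unit interval, so the derivative
      within it is the ordinary one.\<close>
    moreover have "(f has_derivative (*) (f' z)) (at z)" if "c < z" "z < d" for z
      using der[of z] that cd by (simp add: at_within_Icc_at has_field_derivative_def)
    ultimately obtain z where "c < z" "z < d" "f d - f c = f' z * (d - c)"
      using mvt[of c d f "\<lambda>z. (*) (f' z)"] cd by blast
    then show ?thesis by (auto simp: mult.commute)
  qed
  obtain z1 where z1: "a < z1" "z1 < x" "f x - f a = (x - a) * f' z1"
    using mean_value[of a x] x ab by auto
  obtain z2 where z2: "x < z2" "z2 < b" "f b - f x = (b - x) * f' z2"
    using mean_value[of x b] x ab by auto
  have "\<bar>f' z1 - f' z2\<bar> \<le> L * \<bar>z1 - z2\<bar> powr (r - 1)"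
    by (rule hoelder) (use z1 z2 x ab in auto)
  also have "\<dots> \<le> L * (b - a) powr (r - 1)"
    using assms(2,3) z1 z2 by (intro mult_left_mono powr_mono2) auto
  finally have d: "\<bar>f' z1 - f' z2\<bar> \<le> L * (b - a) powr (r - 1)" .
  \<comment> \<open>Split this way, both increments acquire the same factor
    \<open>t * (1 - t) * (b - a)\<close>.\<close>
  have "f x - ((1 - t) * f a + t * f b) = (1 - t) * (f x - f a) - t * (f b - f x)"
    by (simp add: algebra_simps)
  also have "\<dots> = t * (1 - t) * ((b - a) * (f' z1 - f' z2))"
    unfolding z1 z2 xa bx by (simp add: algebra_simps)
  finally have "\<bar>f x - ((1 - t) * f a + t * f b)\<bar> = t * (1 - t) * ((b - a) * \<bar>f' z1 - f' z2\<bar>)"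
    using t ab by (simp add: abs_mult)
  also have "\<dots> \<le> t * (1 - t) * ((b - a) * (L * (b - a) powr (r - 1)))"
    using d t ab by (intro mult_left_mono) auto
  also have "(b - a) * (L * (b - a) powr (r - 1)) = L * (b - a) powr r"
    using ab powr_mult_base[of "b - a" "r - 1"] by simp
  finally show ?thesis by (simp add: x_def)
qed

text \<open>Taken as coefficients, these values give the piecewise linear interpolant of
  \<open>f\<close>, since a hat is 1 at its own knot and 0 at the others.\<close>

definition knot_vec :: "nat \<Rightarrow> (real \<Rightarrow> real) \<Rightarrow> real vec" where
  "knot_vec K f = vec (K + 1) (\<lambda>k. f (real k / real K))"

lemma knot_vec_nth: "k \<le> K \<Longrightarrow> knot_vec K f $ k = f (real k / real K)"
  by (simp add: knot_vec_def)

lemma knot_vec_carrier: "knot_vec K f \<in> carrier_vec (K + 1)"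
  by (simp add: knot_vec_def)

lemma powr_inverse_nat:
  assumes "K > 0"
  shows "(1 / real K) powr r = real K powr (- r)"
  using assms by (simp add: powr_minus_divide powr_divide)

lemma spline_knot_vec_error:
  assumes f: "f \<in> convex_hoelder r L" and "1 < r" "L > 0" and K: "K > 0"
    and x: "0 \<le> x" "x \<le> 1"
  shows "\<bar>f x - spline K (knot_vec K f) x\<bar> \<le> L * real K powr (- r)"
proof -
  obtain j where j: "j < K" "real j \<le> real K * x" "real K * x \<le> real j + 1"
    using knot_interval_exists[OF K x] .
  define t where "t = real K * x - real j"
  have t: "0 \<le> t" "t \<le> 1" using j by (auto simp: t_def)
  let ?a = "real j / real K" and ?b = "real (j + 1) / real K"
  have ab: "0 \<le> ?a" "?a < ?b" "?b \<le> 1" "?b - ?a = 1 / real K"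
    using j(1) K by (auto simp: divide_strict_right_mono field_simps)
  have xx: "(1 - t) * ?a + t * ?b = x"
    using K by (simp add: t_def field_simps)
  have sp: "spline K (knot_vec K f) x = (1 - t) * f ?a + t * f ?b"
    using spline_eq[OF j, of "knot_vec K f"] j(1) by (simp add: knot_vec_nth t_def mult.commute)
  have "\<bar>f x - spline K (knot_vec K f) x\<bar> \<le> t * (1 - t) * (L * (1 / real K) powr r)"
    using convex_hoelder_interpolation[OF f assms(2,3) ab(1-3) t] unfolding xx sp ab(4) .
  also have "\<dots> \<le> 1 * (L * (1 / real K) powr r)"
    using t assms(3) by (intro mult_right_mono mult_le_one) auto
  finally show ?thesis using powr_inverse_nat[OF K] by simp
qed

text \<open>A second difference is twice the gap between chord and function at the middle of two
  adjacent knot intervals. Convexity gives its sign; the interpolation bound with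
  \<open>t = 1 / 2\<close> on length \<open>2 / K\<close> gives its size.\<close>

lemma D2_knot_vec:
  assumes f: "f \<in> convex_hoelder r L" and r: "1 < r" "r \<le> 2" and L: "L > 0" and i: "i < K - 1"
  shows "0 \<le> (D2 K *\<^sub>v knot_vec K f) $ i" "(D2 K *\<^sub>v knot_vec K f) $ i \<le> 2 * (L * real K powr (- r))"
proof -
  let ?a = "real i / real K" and ?b = "real (i + 2) / real K"
  have K: "K > 0" using i by simp
  have ab: "0 \<le> ?a" "?a < ?b" "?b \<le> 1" "?b - ?a = 2 * (1 / real K)"
    using i by (auto simp: divide_strict_right_mono field_simps)
  have mid: "1 / 2 * ?a + 1 / 2 * ?b = real (i + 1) / real K"
    using K by (simp add: field_simps)
  let ?d = "1 / 2 * f ?a + 1 / 2 * f ?b - f (real (i + 1) / real K)"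
  have D: "(D2 K *\<^sub>v knot_vec K f) $ i = 2 * ?d"
    using D2_mult_vec_nth[OF knot_vec_carrier i] i by (simp add: knot_vec_nth)
  have "convex_on {0..1} f" using f by (simp add: convex_hoelder_def)
  then have "f (1 / 2 * ?a + 1 / 2 * ?b) \<le> 1 / 2 * f ?a + 1 / 2 * f ?b"
    using convex_onD[of "{0..1}" f "1 / 2" ?a ?b] ab by simp
  then show "0 \<le> (D2 K *\<^sub>v knot_vec K f) $ i" unfolding D mid by simp
  have "\<bar>f (1 / 2 * ?a + 1 / 2 * ?b) - (1 / 2 * f ?a + 1 / 2 * f ?b)\<bar> \<le> 1 / 4 * (L * (2 * (1 / real K)) powr r)"
    using convex_hoelder_interpolation[OF f r(1) L ab(1-3), of "1 / 2"] unfolding ab(4) by simp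
  then have "?d \<le> 1 / 4 * (L * (2 * (1 / real K)) powr r)" unfolding mid by linarith
  also have "(2 * (1 / real K)) powr r = 2 powr r * (1 / real K) powr r" by (rule powr_mult)
  \<comment> \<open>From \<open>r \<le> 2\<close> follows \<open>2 powr r \<le> 4\<close>, which
    cancels the 1/4.\<close>
  also have "1 / 4 * (L * (2 powr r * (1 / real K) powr r)) \<le> L * (1 / real K) powr r"
    using powr_mono[OF r(2), of 2] L mult_right_mono[of "2 powr r" 4 "(1 / real K) powr r"]
    by (simp add: mult.commute)
  finally show "(D2 K *\<^sub>v knot_vec K f) $ i \<le> 2 * (L * real K powr (- r))"
    unfolding D powr_inverse_nat[OF K] by simp
qed

lemma knot_vec_Omega:
  assumes "f \<in> convex_hoelder r L" "1 < r" "r \<le> 2" "L > 0"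
  shows "knot_vec K f \<in> Omega K"
  using D2_knot_vec(1)[OF assms] D2_carrier[of K]
  by (auto simp: Omega_def less_eq_vec_def knot_vec_carrier[simplified] simp del: index_mult_mat_vec)

section \<open>The residual at the knot values\<close>

text \<open>A column contains each of 1, -2, 1 at most once. Columns matter because the residual
  involves the transpose of \<open>D2\<close>.\<close>

lemma D2_column_abs_sum_le:
  assumes "k \<le> K"
  shows "(\<Sum>i<K - 1. \<bar>D2 K $$ (i, k)\<bar>) \<le> 4"
proof -
  have one: "(\<Sum>i<K - 1. of_bool (i + p = k)) \<le> (1 :: real)" for p
  proof -
    have "{..<K - 1} \<inter> {i. i + p = k} \<subseteq> {k - p}" by auto
    then have "card ({..<K - 1} \<inter> {i. i + p = k}) \<le> 1"
      using card_mono[of "{k - p}"] by fastforce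
    then show ?thesis by (simp add: sum.If_cases of_bool_def)
  qed
  have "(\<Sum>i<K - 1. \<bar>D2 K $$ (i, k)\<bar>)
      \<le> (\<Sum>i<K - 1. of_bool (i + 0 = k) + 2 * of_bool (i + 1 = k) + of_bool (i + 2 = k))"
    by (rule sum_mono) (use assms in \<open>auto simp: D2_def\<close>)
  also have "\<dots> \<le> 4"
    using one[of 0] one[of 1] one[of 2]
    by (simp only: sum.distrib sum_distrib_left[symmetric])
  finally show ?thesis .
qed

text \<open>Hoelder's inequality pairing the sum norm of \<open>w\<close> with the maximum norm of
  \<open>v\<close>.\<close>

lemma abs_weighted_sum_le:
  fixes w v :: "nat \<Rightarrow> real"
  assumes "\<And>i. i < n \<Longrightarrow> \<bar>v i\<bar> \<le> e" "(\<Sum>i<n. \<bar>w i\<bar>) \<le> s" "0 \<le> e"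
  shows "\<bar>\<Sum>i<n. w i * v i\<bar> \<le> s * e"
proof -
  have "\<bar>\<Sum>i<n. w i * v i\<bar> \<le> (\<Sum>i<n. \<bar>w i\<bar> * e)"
    by (intro sum_abs[THEN order_trans] sum_mono) (use assms in \<open>auto simp: abs_mult intro!: mult_left_mono\<close>)
  also have "\<dots> \<le> s * e" using assms by (simp add: sum_distrib_right[symmetric] mult_right_mono)
  finally show ?thesis .
qed


text \<open>Each entry pairs a column of the design matrix with the interpolation errors, divided by
  \<open>beta\<close>, minus \<open>lam\<close> times a column of \<open>D2\<close> paired with the
  second differences. The 16 is \<open>2 * m\<close> over \<open>m / 8\<close>; the 8 is the column
  sum 4 times the bound 2 on second differences.\<close>

lemma linf_norm_residual_le:
  assumes f: "f \<in> convex_hoelder r L" and r: "1 < r" "r \<le> 2" and L: "L > 0"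
    and m: "m > 0" and K: "K \<ge> 2" and lam: "lam \<ge> 0"
  shows "linf_norm ((1 / beta (K * m) K) \<cdot>\<^sub>v (transpose_mat (design_mat (K * m) K) *\<^sub>v sample_vec (K * m) f)
      - Lambda_mat (K * m) K lam *\<^sub>v knot_vec K f) \<le> (16 + 8 * lam) * (L * real K powr (- r))"
    (is "linf_norm (?y1 - ?y2) \<le> _")
proof -
  let ?n = "K * m" and ?b = "knot_vec K f" and ?\<epsilon> = "L * real K powr (- r)"
  let ?X = "design_mat ?n K" and ?D = "D2 K" and ?\<beta> = "beta ?n K"
  have X: "?X \<in> carrier_mat ?n (K + 1)" and D: "?D \<in> carrier_mat (K - 1) (K + 1)"
    by (rule design_mat_carrier, rule D2_carrier)
  have Xb: "?X *\<^sub>v ?b \<in> carrier_vec ?n" and Db: "?D *\<^sub>v ?b \<in> carrier_vec (K - 1)"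
    using X D knot_vec_carrier by (auto intro!: mult_mat_vec_carrier)
  have fv: "sample_vec ?n f \<in> carrier_vec ?n" by (simp add: sample_vec_def)
  have n: "?n > 0" using m K by simp
  have \<beta>: "real m / 8 \<le> ?\<beta>" "?\<beta> > 0" using beta_ge[OF m K] m by auto
  have \<epsilon>: "0 \<le> ?\<epsilon>" using L by simp
  have dim: "dim_vec (?y1 - ?y2) = K + 1"
    using Lambda_mat_carrier[of ?n K lam] by simp
  show ?thesis
  proof (rule linf_norm_le)
    fix k assume "k < dim_vec (?y1 - ?y2)"
    then have k: "k < K + 1" by (simp only: dim)
    have dims: "dim_row (transpose_mat ?X) = K + 1" "dim_row (transpose_mat ?D) = K + 1"
      using X D by auto
    define v where "v i = sample_vec ?n f $ i - (?X *\<^sub>v ?b) $ i" for i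
    have "(?y1 - ?y2) $ k = 1 / ?\<beta> * (transpose_mat ?X *\<^sub>v sample_vec ?n f) $ k
        - (1 / ?\<beta> * (transpose_mat ?X *\<^sub>v (?X *\<^sub>v ?b)) $ k + lam * (transpose_mat ?D *\<^sub>v (?D *\<^sub>v ?b)) $ k)"
      unfolding Lambda_mat_mult_vec[OF knot_vec_carrier] using k dims by simp
    also have "\<dots> = 1 / ?\<beta> * (\<Sum>i<?n. ?X $$ (i, k) * v i) - lam * (\<Sum>i<K - 1. ?D $$ (i, k) * (?D *\<^sub>v ?b) $ i)"
      unfolding transpose_mult_vec_nth[OF X fv k] transpose_mult_vec_nth[OF X Xb k]
        transpose_mult_vec_nth[OF D Db k] v_def
      by (simp add: right_diff_distrib sum_subtractf)
    finally have eq: "(?y1 - ?y2) $ k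
      = 1 / ?\<beta> * (\<Sum>i<?n. ?X $$ (i, k) * v i) - lam * (\<Sum>i<K - 1. ?D $$ (i, k) * (?D *\<^sub>v ?b) $ i)" .
    have "\<bar>v i\<bar> \<le> ?\<epsilon>" if i: "i < ?n" for i
    proof -
      have "real (i + 1) \<le> real ?n" using i by (simp only: of_nat_le_iff)
      then have "real (i + 1) / real ?n \<le> 1" using n by (simp add: divide_le_eq del: of_nat_mult)
      moreover have "v i = f (real (i + 1) / real ?n) - spline K ?b (real (i + 1) / real ?n)"
        using i unfolding v_def design_mat_mult_vec_nth[OF knot_vec_carrier i] by (simp add: sample_vec_def)
      ultimately show ?thesis
        using spline_knot_vec_error[OF f r(1) L, of K "real (i + 1) / real ?n"] K by simp
    qed
    moreover have "(\<Sum>i<?n. \<bar>?X $$ (i, k)\<bar>) \<le> 2 * real m"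
    proof -
      have "(\<Sum>i<?n. \<bar>?X $$ (i, k)\<bar>) = (\<Sum>i<?n. bspline K (k + 1) (real (Suc i) / real ?n))"
        using k by (intro sum.cong) (auto simp: design_mat_def bspline_nonneg)
      also have "\<dots> \<le> 2 * real m"
        using sum_bspline_design_le[OF m, of K "k + 1"] K
        unfolding One_nat_def sum.atLeast1_atMost_eq by simp
      finally show ?thesis .
    qed
    ultimately have "\<bar>\<Sum>i<?n. ?X $$ (i, k) * v i\<bar> \<le> 2 * real m * ?\<epsilon>"
      using \<epsilon> by (intro abs_weighted_sum_le)
    also have "\<dots> \<le> 16 * ?\<beta> * ?\<epsilon>" using \<beta> \<epsilon> by (intro mult_right_mono) auto
    finally have "1 / ?\<beta> * \<bar>\<Sum>i<?n. ?X $$ (i, k) * v i\<bar> \<le> 1 / ?\<beta> * (16 * ?\<beta> * ?\<epsilon>)"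
      using \<beta> by (intro mult_left_mono) auto
    then have 1: "\<bar>1 / ?\<beta> * (\<Sum>i<?n. ?X $$ (i, k) * v i)\<bar> \<le> 16 * ?\<epsilon>"
      using \<beta> by (simp add: abs_mult)
    have "\<bar>\<Sum>i<K - 1. ?D $$ (i, k) * (?D *\<^sub>v ?b) $ i\<bar> \<le> 4 * (2 * ?\<epsilon>)"
      using D2_knot_vec[OF f r L] D2_column_abs_sum_le[of k K] k \<epsilon>
      by (intro abs_weighted_sum_le) (auto simp: abs_le_iff intro: order_trans[of _ 0])
    then have "lam * \<bar>\<Sum>i<K - 1. ?D $$ (i, k) * (?D *\<^sub>v ?b) $ i\<bar> \<le> lam * (4 * (2 * ?\<epsilon>))"
      using lam by (intro mult_left_mono)
    then have 2: "\<bar>lam * (\<Sum>i<K - 1. ?D $$ (i, k) * (?D *\<^sub>v ?b) $ i)\<bar> \<le> 8 * lam * ?\<epsilon>"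
      using lam by (simp add: abs_mult algebra_simps)
    have "\<bar>(?y1 - ?y2) $ k\<bar> \<le> 16 * ?\<epsilon> + 8 * lam * ?\<epsilon>"
      unfolding eq using abs_triangle_ineq4 1 2 by (rule order_trans[OF _ add_mono])
    then show "\<bar>(?y1 - ?y2) $ k\<bar> \<le> (16 + 8 * lam) * ?\<epsilon>" by (simp add: algebra_simps)
  qed (use dim in linarith)
qed

section \<open>Failure of the Lipschitz property with one design point per interval\<close>

text \<open>With one design point per knot interval no design point sees the first basis function, so for
  \<open>\<lambda> = 0\<close> the objective is unbounded below in that direction as soon as the right-hand side has a
  component there: \<open>bhat\<close> is then a choice from the empty set, which does not depend on the data.\<close>

lemma bhat_unattained:
  assumes c: "c \<in> carrier_vec 3" and t: "t > 0"
  shows "bhat 2 2 0 (Lambda_mat 2 2 0 *\<^sub>v c + t \<cdot>\<^sub>v unit_vec 3 0) = (SOME b. False)"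
proof -
  let ?e = "unit_vec 3 0 :: real vec" and ?X = "design_mat 2 2" and ?\<Lambda> = "Lambda_mat 2 2 0"
  let ?y = "?\<Lambda> *\<^sub>v c + t \<cdot>\<^sub>v ?e"
  have X: "?X \<in> carrier_mat 2 3" using design_mat_carrier[of 2 2] by simp
  have \<Lambda>: "?\<Lambda> \<in> carrier_mat 3 3" using Lambda_mat_carrier[of 2 2 0] by simp
  have e: "?e \<in> carrier_vec 3" by simp
  \<comment> \<open>The design points 1/2 and 1 are both knots, with coefficients 1 and 2 of the
    unit vector.\<close>
  have Xe: "?X *\<^sub>v ?e = 0\<^sub>v 2"
  proof (rule eq_vecI)
    fix i assume "i < dim_vec (0\<^sub>v 2 :: real vec)"
    then have i: "i < 2" by simp
    then show "(?X *\<^sub>v ?e) $ i = 0\<^sub>v 2 $ i"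
      using design_mat_mult_vec_nth[of ?e 2 i 2] spline_knot[of 2 "i + 1" ?e] by simp
  qed (use X in simp)
  have A: "scalar_prod a (?\<Lambda> *\<^sub>v d) = 1 / beta 2 2 * scalar_prod (?X *\<^sub>v a) (?X *\<^sub>v d)"
    if "a \<in> carrier_vec 3" "d \<in> carrier_vec 3" for a d
    using scalar_prod_Lambda_mat[of a 2 d 2 0] that by simp
  have "\<not> is_arg_min (objective 2 2 0 ?y) (\<lambda>b. b \<in> Omega 2) b" for b
  proof
    assume min: "is_arg_min (objective 2 2 0 ?y) (\<lambda>b. b \<in> Omega 2) b"
    then have b: "b \<in> Omega 2" by (simp add: is_arg_min_def)
    then have bc: "b \<in> carrier_vec 3" using Omega_carrier by fastforce
    have bec: "b + ?e \<in> carrier_vec 3" using bc by simp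
    \<comment> \<open>Adding \<open>?e\<close> raises the only second difference by 1.\<close>
    have "b + ?e \<in> Omega 2"
    proof -
      have "(D2 2 *\<^sub>v b) $ 0 \<ge> 0" using b by (auto simp: Omega_def less_eq_vec_def)
      then have "(D2 2 *\<^sub>v (b + ?e)) $ 0 \<ge> 0"
        using D2_mult_vec_nth[of b 2 0] D2_mult_vec_nth[of "b + ?e" 2 0] bc by simp
      then show ?thesis using bec D2_carrier[of 2] by (auto simp: Omega_def less_eq_vec_def)
    qed
    then have "\<not> objective 2 2 0 ?y (b + ?e) < objective 2 2 0 ?y b"
      using min by (auto simp: is_arg_min_def)
    \<comment> \<open>The quadratic form does not see \<open>?e\<close>, while the subtracted linear
      term grows by \<open>t\<close>.\<close>
    moreover have "objective 2 2 0 ?y (b + ?e) = objective 2 2 0 ?y b - t"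
    proof -
      have "?X *\<^sub>v (b + ?e) = ?X *\<^sub>v b"
        using mult_add_distrib_mat_vec[OF X bc e] Xe X bc by simp
      then have Q: "scalar_prod (b + ?e) (?\<Lambda> *\<^sub>v (b + ?e)) = scalar_prod b (?\<Lambda> *\<^sub>v b)"
        using A[OF bec bec] A[OF bc bc] by simp
      have "scalar_prod ?e (?\<Lambda> *\<^sub>v c) = 0"
        using A[OF e c] Xe X c by simp
      then have "scalar_prod ?e ?y = t"
        using scalar_prod_add_distrib[of ?e 3 "?\<Lambda> *\<^sub>v c" "t \<cdot>\<^sub>v ?e"] \<Lambda> c by simp
      moreover have "scalar_prod (b + ?e) ?y = scalar_prod b ?y + scalar_prod ?e ?y"
        by (rule add_scalar_prod_distrib[of _ 3]) (use bc \<Lambda> c in auto)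
      ultimately show ?thesis unfolding objective_def Q by simp
    qed
    ultimately show False using t by simp
  qed
  then show ?thesis by (simp add: bhat_eq)
qed

text \<open>For \<open>P \<le> 1\<close> the case \<open>n = K = 2\<close>, \<open>lam = 0\<close>
  is admissible. There a perturbation of the data \<open>\<Lambda> c\<close> by any
  \<open>t > 0\<close> along the first unit vector yields one fixed vector \<open>?u\<close>,
  whatever \<open>c\<close> is. The Lipschitz bound for small \<open>t\<close> then forces
  \<open>?u\<close> close to contradictory fits.\<close>

lemma uniform_lipschitz_imp_ge_2:
  assumes lip: "uniform_lipschitz lambar P" and "lambar \<ge> 0"
  shows "P \<ge> 2"
proof (rule ccontr)
  assume "\<not> P \<ge> 2"
  then have P: "real P \<le> 1" by simp
  obtain \<kappa> where \<kappa>: "\<kappa> > 0"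
    and ineq: "\<And>y1 y2. \<lbrakk>y1 \<in> carrier_vec 3; y2 \<in> carrier_vec 3\<rbrakk> \<Longrightarrow>
      linf_norm (bhat 2 2 0 y1 - bhat 2 2 0 y2) \<le> \<kappa> * linf_norm (y1 - y2)"
  proof -
    obtain \<kappa> where "\<kappa> > 0" and *: "\<forall>lam\<in>{0..lambar}. \<forall>n K.
        n > 0 \<and> K \<ge> 2 \<and> K dvd n \<and> real n / real K \<ge> real P \<longrightarrow>
        (\<forall>y1\<in>carrier_vec (K + 1). \<forall>y2\<in>carrier_vec (K + 1).
           linf_norm (bhat n K lam y1 - bhat n K lam y2) \<le> \<kappa> * linf_norm (y1 - y2))"
      using lip unfolding uniform_lipschitz_def by blast
    have "\<forall>y1\<in>carrier_vec (2 + 1). \<forall>y2\<in>carrier_vec (2 + 1).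
           linf_norm (bhat 2 2 0 y1 - bhat 2 2 0 y2) \<le> \<kappa> * linf_norm (y1 - y2)"
      using *[rule_format, of 0 2 2] assms(2) P by simp
    with \<open>\<kappa> > 0\<close> show ?thesis by (intro that[of \<kappa>]) auto
  qed
  let ?\<Lambda> = "Lambda_mat 2 2 0" and ?u = "(SOME b. False) :: real vec"
  have \<Lambda>: "?\<Lambda> \<in> carrier_mat 3 3" using Lambda_mat_carrier[of 2 2 0] by simp
  have beta: "beta 2 2 > 0" using beta_ge[of 1 2] by simp
  have near: "\<bar>?u $ 2 - c $ 2\<bar> \<le> 1 / 4" if c: "c \<in> Omega 2" for c
  proof -
    have cc: "c \<in> carrier_vec 3" using Omega_carrier[OF c] by simp
    \<comment> \<open>Makes \<open>\<kappa> * t = 1 / 4\<close>, less than half the gap 1 between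
      the two fits compared at the end.\<close>
    define t where "t = 1 / (4 * \<kappa>)"
    have t: "t > 0" using \<kappa> by (simp add: t_def)
    let ?y = "?\<Lambda> *\<^sub>v c" and ?b = "bhat 2 2 0 (?\<Lambda> *\<^sub>v c)"
    have b: "?b \<in> Omega 2" "design_mat 2 2 *\<^sub>v ?b = design_mat 2 2 *\<^sub>v c"
      by (rule bhat_Lambda_mat[OF c _ beta]; simp)+
    have bc: "?b \<in> carrier_vec 3" using Omega_carrier[OF b(1)] by simp
    \<comment> \<open>Only the fitted values of \<open>?b\<close> are known. Index 2 belongs to the
      knot 1, the design point of row 1, where fitted value and coefficient agree.\<close>
    have b2: "?b $ 2 = c $ 2"
      using arg_cong[OF b(2), of "\<lambda>v. v $ 1"] design_mat_mult_vec_nth[of ?b 2 1 2]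
        design_mat_mult_vec_nth[of c 2 1 2] spline_knot[of 2 2 ?b] spline_knot[of 2 2 c] bc cc
      by (simp add: numeral_2_eq_2[symmetric])
    have "\<bar>(?u - ?b) $ 2\<bar> \<le> linf_norm (?u - ?b)"
      by (rule abs_nth_le_linf_norm) (use bc in simp)
    also have "\<dots> \<le> \<kappa> * linf_norm ((?y + t \<cdot>\<^sub>v unit_vec 3 0) - ?y)"
      unfolding bhat_unattained[OF cc t, symmetric] by (rule ineq) (use \<Lambda> cc in auto)
    also have "linf_norm ((?y + t \<cdot>\<^sub>v unit_vec 3 0) - ?y) \<le> t"
      by (rule linf_norm_le) (use \<Lambda> t in auto)
    finally have "\<bar>(?u - ?b) $ 2\<bar> \<le> \<kappa> * t" using \<kappa> by simp
    then show ?thesis using bc b2 \<kappa> by (simp add: t_def)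
  qed
  \<comment> \<open>These two vectors differ by 1 at index 2, yet both would be within 1/4 of
    \<open>?u\<close> there.\<close>
  have "unit_vec 3 2 \<in> Omega 2" "0\<^sub>v 3 \<in> Omega 2"
    using D2_mult_vec_nth[of "unit_vec 3 2" 2 0] D2_mult_vec_nth[of "0\<^sub>v 3" 2 0] D2_carrier[of 2]
    by (auto simp: Omega_def less_eq_vec_def)
  from this[THEN near] show False by simp
qed

section \<open>The uniform approximation bound\<close>

theorem proposition4p4:
  fixes r L lambar :: real and P :: nat
  assumes "1 < r" and "r \<le> 2" and "L > 0" and "lambar > 0"
    and "uniform_lipschitz lambar P"
  shows "\<exists>C1>0. \<exists>C2>0. \<forall>\<^sub>F K in sequentially.
           \<forall>n. n > 0 \<and> K \<ge> 2 \<and> K dvd n \<and> real n / real K \<ge> real P \<longrightarrow>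
             (\<forall>lam\<in>{0..lambar}.
               (SUP f\<in>convex_hoelder r L. sup_norm (\<lambda>x. fbar n K lam f x - f x))
                 \<le> ereal (C1 * L * real K powr (- r)
                          + C2 * sqrt (lam * real K) * (L * real K powr (- r))))"
proof -
  have P: "P \<ge> 2" using uniform_lipschitz_imp_ge_2 assms(4,5) by simp
  obtain \<kappa> where \<kappa>: "\<kappa> > 0" and lip: "\<forall>lam\<in>{0..lambar}. \<forall>n K.
        n > 0 \<and> K \<ge> 2 \<and> K dvd n \<and> real n / real K \<ge> real P \<longrightarrow>
        (\<forall>y1\<in>carrier_vec (K + 1). \<forall>y2\<in>carrier_vec (K + 1).
           linf_norm (bhat n K lam y1 - bhat n K lam y2) \<le> \<kappa> * linf_norm (y1 - y2))"
    using assms(5) unfolding uniform_lipschitz_def by blast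
  \<comment> \<open>The Lipschitz constant times the residual bound at the largest
    \<open>lam\<close>, plus 1 for the interpolation error of \<open>f\<close>.\<close>
  define C1 where "C1 = \<kappa> * (16 + 8 * lambar) + 1"
  have C1: "C1 > 0" unfolding C1_def using \<kappa> assms(4) by (simp add: add_pos_pos)
  have main: "\<bar>fbar n K lam f x - f x\<bar>
      \<le> C1 * L * real K powr (- r) + 1 * sqrt (lam * real K) * (L * real K powr (- r))"
    if n: "n > 0" and K: "K \<ge> 2" "K dvd n" and nK: "real n / real K \<ge> real P"
      and lam: "lam \<in> {0..lambar}" and f: "f \<in> convex_hoelder r L" and x: "0 \<le> x" "x \<le> 1"
    for n K lam f x
  proof -
    obtain m where m: "n = K * m" using K(2) by blast
    \<comment> \<open>Here \<open>m = n / K\<close>, which is at least \<open>P\<close> and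
      therefore at least 2.\<close>
    have m2: "m \<ge> 2" using nK P K m by simp
    let ?\<epsilon> = "L * real K powr (- r)" and ?b = "knot_vec K f"
    let ?y1 = "(1 / beta n K) \<cdot>\<^sub>v (transpose_mat (design_mat n K) *\<^sub>v sample_vec n f)"
    let ?y2 = "Lambda_mat n K lam *\<^sub>v ?b"
    have \<epsilon>: "0 \<le> ?\<epsilon>" using assms(3) by simp
    have b_fixed: "bhat n K lam ?y2 = ?b"
      unfolding m by (rule bhat_Lambda_mat_eq[OF m2 K(1) _ knot_vec_Omega[OF f assms(1-3)]])
        (use lam in simp)
    have y1: "?y1 \<in> carrier_vec (K + 1)"
      unfolding carrier_vec_def using design_mat_carrier[of n K] by simp
    have y2: "?y2 \<in> carrier_vec (K + 1)"
      by (rule mult_mat_vec_carrier[OF Lambda_mat_carrier knot_vec_carrier])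
    have "linf_norm (bhat n K lam ?y1 - bhat n K lam ?y2) \<le> \<kappa> * linf_norm (?y1 - ?y2)"
      using lip lam n K nK y1 y2 by blast
    then have "linf_norm (bcheck n K lam f - ?b) \<le> \<kappa> * linf_norm (?y1 - ?y2)"
      unfolding bcheck_def b_fixed .
    also have "\<dots> \<le> \<kappa> * ((16 + 8 * lam) * ?\<epsilon>)"
      unfolding m using linf_norm_residual_le[OF f assms(1-3) _ K(1)] \<kappa> m2 lam
      by (intro mult_left_mono) auto
    also have "\<dots> \<le> \<kappa> * ((16 + 8 * lambar) * ?\<epsilon>)"
      using \<kappa> \<epsilon> lam by (intro mult_left_mono mult_right_mono) auto
    finally have lb: "linf_norm (bcheck n K lam f - ?b) \<le> \<kappa> * ((16 + 8 * lambar) * ?\<epsilon>)" .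
    have "\<bar>bcheck n K lam f $ k - ?b $ k\<bar> \<le> \<kappa> * ((16 + 8 * lambar) * ?\<epsilon>)" if "k \<le> K" for k
      using abs_nth_le_linf_norm[of k "bcheck n K lam f - ?b"] that lb knot_vec_carrier[of K f]
      by auto
    then have "\<bar>spline K (bcheck n K lam f) x - spline K ?b x\<bar> \<le> \<kappa> * ((16 + 8 * lambar) * ?\<epsilon>)"
      using K(1) x by (intro abs_spline_diff_le) auto
    moreover have "\<bar>f x - spline K ?b x\<bar> \<le> ?\<epsilon>"
      using spline_knot_vec_error[OF f assms(1,3) _ x] K(1) by simp
    moreover have "fbar n K lam f x = spline K (bcheck n K lam f) x"
      by (simp add: fbar_def spline_def)
    ultimately have "\<bar>fbar n K lam f x - f x\<bar> \<le> \<kappa> * ((16 + 8 * lambar) * ?\<epsilon>) + ?\<epsilon>"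
      by linarith
    also have "\<dots> = C1 * L * real K powr (- r)" by (simp add: C1_def algebra_simps)
    \<comment> \<open>The square root term is nonnegative and can be added with any positive
      constant; 1 is taken as \<open>C2\<close>.\<close>
    finally show ?thesis using \<epsilon> lam by (simp add: add_increasing2)
  qed
  have "(SUP f\<in>convex_hoelder r L. sup_norm (\<lambda>x. fbar n K lam f x - f x))
      \<le> ereal (C1 * L * real K powr (- r) + 1 * sqrt (lam * real K) * (L * real K powr (- r)))"
    if "n > 0 \<and> K \<ge> 2 \<and> K dvd n \<and> real n / real K \<ge> real P" "lam \<in> {0..lambar}" for n K lam
    unfolding sup_norm_def
  proof (intro SUP_least)
    fix f x assume "f \<in> convex_hoelder r L" "x \<in> {0..1 :: real}"
    then show "ereal \<bar>fbar n K lam f x - f x\<bar>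
        \<le> ereal (C1 * L * real K powr (- r) + 1 * sqrt (lam * real K) * (L * real K powr (- r)))"
      using main[of n K lam f x] that by simp
  qed
  then show ?thesis
    using C1 by (intro exI[of _ C1] exI[of _ 1] conjI always_eventually allI impI ballI) auto
qed

end
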